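(* Let $\mathcal{X}$ be an input space, let $F_\theta(\cdot\mid x)$, $x\in\mathcal{X}$, be predictive cumulative distribution functions (CDFs) on $\mathbb{R}$, each strictly increasing, with quantile functions $Q_\theta(\cdot\mid x)$. Let $\mathcal{D}'=\{(X'_i,Y'_i)\}_{i=1}^{N'}$, $N'\ge 1$, be a calibration dataset of i.i.d. draws from a distribution $P_{X,Y}$ on $\mathcal{X}\times\mathbb{R}$, and let $Z'_i=F_\theta(Y'_i\mid X'_i)$ for $i=1,\dots,N'$. Consider quantile recalibration of $F_\theta$ with the calibration map $$\phi_{\mathrm{DCP}}(\alpha)=\frac{1}{N'+1}\sum_{i=1}^{N'}\mathbb{1}(Z'_i\le \alpha),\qquad \alpha\in[0,1],$$ which returns $F'_\theta(y\mid x)=\phi_{\mathrm{DCP}}(F_\theta(y\mid x))$ for $y\in\mathbb{R}$, $x\in\mathcal{X}$. Then quantile recalibration with this calibration map is equivalent to Distributional Conformal Prediction (DCP) of left intervals at each coverage level $\alpha\in[0,1]$. That is, for every $x\in\mathcal{X}$ and every $\alpha\in[0,1]$, the endpoint $Q'_\theta(\alpha\mid x)$ of the DCP left prediction interval $(-\infty,Q'_\theta(\alpha\mid x)]$ at level $\alpha$ is the $\alpha$-quantile of the recalibrated distribution: $$Q'_\theta(\alpha\mid x)=\inf\{y\in\mathbb{R}: F'_\theta(y\mid x)\ge \alpha\}.$$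
   Context: Quantile functions: $Q_\theta(p\mid x)=\inf\{y\in\mathbb{R}:F_\theta(y\mid x)\ge p\}$, with values in $[-\infty,+\infty]$ and the conventions $\inf\emptyset=+\infty$ and $\inf\mathbb{R}=-\infty$. The same formula is used for $p=\pm\infty$, so $Q_\theta(+\infty\mid x)=+\infty$ and $Q_\theta(-\infty\mid x)=-\infty$. Quantile recalibration: given a predictive CDF $F_\theta$, a calibration dataset $\mathcal{D}'$ and a calibration map $\phi:[0,1]\to[0,1]$ computed from the values $Z'_i=F_\theta(Y'_i\mid X'_i)$, it returns the recalibrated function $F'_\theta(\cdot\mid x)=\phi(F_\theta(\cdot\mid x))$. With $\phi=\phi_{\mathrm{DCP}}$, the function $F'_\theta(\cdot\mid x)$ tends to $N'/(N'+1)$ at $+\infty$; the remaining mass $1/(N'+1)$ is understood to be placed at $+\infty$. Distributional Conformal Prediction (DCP) of left intervals: this is inductive conformal prediction with conformity score $s_\theta(y\mid x)=F_\theta(y\mid x)$, which is required to be strictly increasing in $y$. At coverage level $\alpha$ it computes the scores $Z'_i=F_\theta(Y'_i\mid X'_i)$, sets $\hat q=Z'_{(\lceil (N'+1)\alpha\rceil)}$, where $Z'_{(k)}$ denotes the $k$-th smallest value among $\{Z'_1,\dots,Z'_{N'},+\infty\}$ counted with multiplicity (with $Z'_{(0)}=-\infty$), and returns the conformalized quantile $Q'_\theta(\alpha\mid x)=Q_\theta(\hat q\mid x)$, i.e. the left prediction interval $(-\infty,Q'_\theta(\alpha\mid x)]$. *)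

theory Defs
  imports "HOL-Probability.Probability"
begin

definition is_cdf :: "(real \<Rightarrow> real) \<Rightarrow> bool" where
  "is_cdf G \<longleftrightarrow> (\<exists>\<mu>. real_distribution \<mu> \<and> G = cdf \<mu>)"

(* The infimum is taken in ereal, so that it is \<infinity> over the empty set and -\<infinity> over
   the whole real line; the level p may itself be \<plusminus>\<infinity>. *)
definition quantile :: "(real \<Rightarrow> real) \<Rightarrow> ereal \<Rightarrow> ereal" where
  "quantile G p = Inf (ereal ` {y. ereal (G y) \<ge> p})"

(* A calibration dataset is a function d whose values at 1, ..., N are the
   pairs (X'_i, Y'_i). *)
definition calib_score :: "('x \<Rightarrow> real \<Rightarrow> real) \<Rightarrow> (nat \<Rightarrow> 'x \<times> real) \<Rightarrow> nat \<Rightarrow> real" where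
  "calib_score F d i = F (fst (d i)) (snd (d i))"

definition recalibrate ::
    "(real \<Rightarrow> real) \<Rightarrow> ('x \<Rightarrow> real \<Rightarrow> real) \<Rightarrow> 'x \<Rightarrow> real \<Rightarrow> real" where
  "recalibrate \<phi> F x y = \<phi> (F x y)"

definition phi_dcp :: "nat \<Rightarrow> (nat \<Rightarrow> real) \<Rightarrow> real \<Rightarrow> real" where
  "phi_dcp N Z \<alpha> = 1 / (real N + 1) * (\<Sum>i=1..N. indicator {..\<alpha>} (Z i))"

(* The k-th smallest element, with multiplicity, of Z 1, ..., Z N, \<infinity>;
   meaningful for k \<le> N + 1. *)
definition order_stat :: "nat \<Rightarrow> (nat \<Rightarrow> real) \<Rightarrow> nat \<Rightarrow> ereal" where
  "order_stat N Z k =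
     (if k = 0 then -\<infinity>
      else sort (map (\<lambda>i. ereal (Z i)) [1..<N + 1] @ [\<infinity>]) ! (k - 1))"

definition conformal_threshold :: "nat \<Rightarrow> (nat \<Rightarrow> real) \<Rightarrow> real \<Rightarrow> ereal" where
  "conformal_threshold N Z \<alpha> = order_stat N Z (nat \<lceil>(real N + 1) * \<alpha>\<rceil>)"

definition dcp_quantile ::
    "('x \<Rightarrow> real \<Rightarrow> real) \<Rightarrow> nat \<Rightarrow> (nat \<Rightarrow> 'x \<times> real) \<Rightarrow> real \<Rightarrow> 'x \<Rightarrow> ereal" where
  "dcp_quantile F N d \<alpha> x =
     quantile (F x) (conformal_threshold N (calib_score F d) \<alpha>)"

end

theory Submission
  imports Defs
begin

text \<open>
  For every real \<open>t\<close>, the order statistic of index \<open>\<lceil>(N + 1) \<alpha>\<rceil>\<close> is at most \<open>t\<close> iff at least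
  \<open>(N + 1) \<alpha>\<close> of the scores are, i.e. iff \<open>\<alpha> \<le> \<phi>\<^sub>D\<^sub>C\<^sub>P(t)\<close>. With \<open>t = F(y | x)\<close>, the two quantiles are
  infima of the same set of \<open>y\<close>.
\<close>

text \<open>Sortedness makes the entries that are at most \<open>t\<close> an initial segment, so
  with indices from 0 they occupy exactly the positions below their number.\<close>

lemma sorted_nth_le_iff_count:
  assumes "sorted xs" "k < length xs"
  shows "xs ! k \<le> t \<longleftrightarrow> k < length (filter (\<lambda>x. x \<le> t) xs)"
  using assms
proof (induction xs arbitrary: k)
  case Nil
  then show ?case by simp
next
  case (Cons a xs)
  show ?case
  proof (cases "a \<le> t")
    case True
    then show ?thesis using Cons by (cases k) auto
  next
    case False
    \<comment> \<open>A head above \<open>t\<close> forces every entry above \<open>t\<close>: the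
      filter is empty and both sides are false.\<close>
    then have "\<forall>x\<in>set (a # xs). \<not> x \<le> t"
      using Cons.prems(1) by force
    then show ?thesis
      using Cons.prems(2) nth_mem[of k "a # xs"] by (auto simp: filter_empty_conv)
  qed
qed

lemma order_stat_le_iff:
  assumes "k \<le> N + 1"
  shows "order_stat N Z k \<le> ereal t \<longleftrightarrow> k \<le> card {i\<in>{1..N}. Z i \<le> t}"
proof (cases k)
  case 0
  then show ?thesis by (simp add: order_stat_def)
next
  case (Suc j)
  define xs where "xs = map (\<lambda>i. ereal (Z i)) [1..<N + 1] @ [\<infinity>]"
  have "length (filter (\<lambda>v. v \<le> ereal t) (sort xs)) = length (filter (\<lambda>v. v \<le> ereal t) xs)"
    by (metis filter_sort length_sort sort_key_const)
  \<comment> \<open>The appended \<open>\<infinity>\<close> lies above every real \<open>t\<close>,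
    so only genuine scores are counted.\<close>
  also have "\<dots> = length (filter (\<lambda>i. Z i \<le> t) [1..<N + 1])"
    by (simp add: xs_def filter_map comp_def)
  also have "\<dots> = card {i\<in>{1..N}. Z i \<le> t}"
    by (subst distinct_length_filter) (auto intro!: arg_cong[where f = card])
  finally have "length (filter (\<lambda>v. v \<le> ereal t) (sort xs)) = card {i\<in>{1..N}. Z i \<le> t}" .
  moreover have "order_stat N Z k = sort xs ! j"
    using Suc by (simp add: order_stat_def xs_def)
  \<comment> \<open>The list has N + 1 entries, so the bound on \<open>k\<close> keeps the lookup in
    range. As \<open>k = Suc j\<close>, the strict bound on \<open>j\<close> becomes
    \<open>k \<le> card ...\<close>.\<close>
  moreover have "j < length (sort xs)"
    using Suc assms by (simp add: xs_def)
  ultimately show ?thesis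
    using sorted_nth_le_iff_count[OF sorted_sort, of j xs "ereal t"] Suc by auto
qed

lemma phi_dcp_eq_card: "phi_dcp N Z t = card {i\<in>{1..N}. Z i \<le> t} / (real N + 1)"
proof -
  have "(\<Sum>i=1..N. indicator {..t} (Z i)) = (\<Sum>i=1..N. of_bool (Z i \<le> t) :: real)"
    by (simp add: indicator_def)
  also have "\<dots> = card {i\<in>{1..N}. Z i \<le> t}"
    by (simp add: Int_def)
  finally show ?thesis by (simp add: phi_dcp_def)
qed

lemma conformal_threshold_le_iff:
  assumes "\<alpha> \<le> 1"
  shows "conformal_threshold N Z \<alpha> \<le> ereal t \<longleftrightarrow> \<alpha> \<le> phi_dcp N Z t"
proof -
  have "(real N + 1) * \<alpha> \<le> real N + 1"
    using assms by (intro mult_left_le) auto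
  \<comment> \<open>This is where \<alpha> \<le> 1 enters: the index reaches at most the final entry
    \<open>\<infinity>\<close>.\<close>
  then have "nat \<lceil>(real N + 1) * \<alpha>\<rceil> \<le> N + 1"
    by (subst nat_le_iff, subst ceiling_le_iff) linarith
  then have "conformal_threshold N Z \<alpha> \<le> ereal t \<longleftrightarrow>
      nat \<lceil>(real N + 1) * \<alpha>\<rceil> \<le> card {i\<in>{1..N}. Z i \<le> t}"
    unfolding conformal_threshold_def by (rule order_stat_le_iff)
  \<comment> \<open>The cardinality is a nonnegative integer, so neither the rounding up nor the
    truncation by \<open>nat\<close> affects the comparison.\<close>
  also have "\<dots> \<longleftrightarrow> (real N + 1) * \<alpha> \<le> card {i\<in>{1..N}. Z i \<le> t}"
    by (simp add: nat_le_iff ceiling_le_iff)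
  also have "\<dots> \<longleftrightarrow> \<alpha> \<le> phi_dcp N Z t"
    by (simp add: phi_dcp_eq_card pos_le_divide_eq mult.commute)
  finally show ?thesis .
qed

theorem theorem1:
  fixes S :: "'x measure"
    and F :: "'x \<Rightarrow> real \<Rightarrow> real"
    and P :: "('x \<times> real) measure"
    and M :: "'w measure"
    and X :: "nat \<Rightarrow> 'w \<Rightarrow> 'x"
    and Y :: "nat \<Rightarrow> 'w \<Rightarrow> real"
    and N :: nat
  assumes cdf: "\<And>x. x \<in> space S \<Longrightarrow> is_cdf (F x)"
    and incr: "\<And>x. x \<in> space S \<Longrightarrow> strict_mono (F x)"
    and N: "N \<ge> 1"
    and P: "prob_space P" "sets P = sets (S \<Otimes>\<^sub>M borel)"
    and M: "prob_space M"
    and indep: "prob_space.indep_vars M (\<lambda>_. S \<Otimes>\<^sub>M borel) (\<lambda>i \<omega>. (X i \<omega>, Y i \<omega>)) {1..N}"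
    and ident: "\<And>i. i \<in> {1..N} \<Longrightarrow> distr M (S \<Otimes>\<^sub>M borel) (\<lambda>\<omega>. (X i \<omega>, Y i \<omega>)) = P"
  shows "\<forall>\<omega>\<in>space M. \<forall>x\<in>space S. \<forall>\<alpha>\<in>{0..1}.
           (let d = (\<lambda>i. (X i \<omega>, Y i \<omega>));
                F' = recalibrate (phi_dcp N (calib_score F d)) F
            in dcp_quantile F N d \<alpha> x = quantile (F' x) (ereal \<alpha>))"
  by (simp add: Let_def dcp_quantile_def quantile_def recalibrate_def conformal_threshold_le_iff)

end
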